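(* Let $G$ be a finite group. Then for any $q\ge2$, $$B(q,G)=\operatorname*{colim}_{A\in\mathcal N_q(G)}BA .$$
   Context: For a group $Q$, set $\Gamma^1(Q)=Q$, $\Gamma^{i+1}(Q)=[\Gamma^i(Q),Q]$, with $\Gamma^\infty(Q)=\{1\}$. Let $F_n$ be the free group on $n$ generators and $\Gamma^q=\Gamma^q(F_n)$. $Hom(F_n/\Gamma^q,G)$ is the set of homomorphisms $F_n\to G$ trivial on $\Gamma^q$, identified with a subset of $G^n$ via the images of the generators. $B_*(q,G)$ is the simplicial space with $B_n(q,G)=Hom(F_n/\Gamma^q,G)$, faces $d_0(g_1,\dots,g_n)=(g_2,\dots,g_n)$, $d_i(g_1,\dots,g_n)=(g_1,\dots,g_ig_{i+1},\dots,g_n)$ for $0<i<n$, $d_n(g_1,\dots,g_n)=(g_1,\dots,g_{n-1})$, and degeneracies $s_j$ inserting $1$ after $g_j$. $B(q,G)$ is its geometric realization; $BG=B(\infty,G)$ is the usual bar-construction model of the classifying space, and similarly $BA=B(\infty,A)$ for a subgroup $A\subset G$; $B(q,G)$ and all $BA$ are subspaces of $BG$. $\mathcal N_q(G)=\{A\subset G\text{ a subgroup}\mid\Gamma^q(A)=\{1\}\}$, the poset under inclusion of subgroups of nilpotency class less than $q$. The colimit is taken in topological spaces over this poset along the inclusions $BA\subset BA'$ for $A\subset A'$; the identification is the one induced by the inclusions $BA\subset B(q,G)$. *)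

theory Defs
  imports "HOL-Algebra.Generated_Groups" "HOL-Homology.Simplices"
    "HOL-Library.Extended_Nat"
begin

section \<open>Quotients by generated equivalence relations\<close>

definition generated_equiv :: "'a set \<Rightarrow> 'a rel \<Rightarrow> 'a rel" where
  "generated_equiv S R =
     {(x, y). x \<in> S \<and> y \<in> S \<and> equivclp (\<lambda>u v. u \<in> S \<and> v \<in> S \<and> (u, v) \<in> R) x y}"

lemma equiv_generated_equiv: "equiv S (generated_equiv S R)"
proof (rule equivI)
  let ?r = "\<lambda>u v. u \<in> S \<and> v \<in> S \<and> (u, v) \<in> R"
  show "generated_equiv S R \<subseteq> S \<times> S"
    by (auto simp: generated_equiv_def)
  show "refl_on S (generated_equiv S R)"
    by (auto simp: refl_on_def generated_equiv_def)
  show "sym (generated_equiv S R)"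
    by (auto simp: sym_def generated_equiv_def intro: equivclp_sym)
  show "trans (generated_equiv S R)"
    unfolding trans_def generated_equiv_def by (auto intro: equivclp_trans)
qed

definition quotient_topology :: "'a topology \<Rightarrow> 'a rel \<Rightarrow> 'a set topology" where
  "quotient_topology X R =
     topology (\<lambda>U. U \<subseteq> topspace X // generated_equiv (topspace X) R \<and> openin X (\<Union>U))"

lemma openin_quotient_topology:
  "openin (quotient_topology X R) U \<longleftrightarrow>
     U \<subseteq> topspace X // generated_equiv (topspace X) R \<and> openin X (\<Union>U)"
proof -
  let ?Q = "topspace X // generated_equiv (topspace X) R"
  have disj: "c = d" if "c \<in> ?Q" "d \<in> ?Q" "x \<in> c" "x \<in> d" for c d x
    using quotient_disj[OF equiv_generated_equiv that(1,2)] that(3,4) by blast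
  have int: "\<Union>(S \<inter> T) = \<Union>S \<inter> \<Union>T" if S: "S \<subseteq> ?Q" and T: "T \<subseteq> ?Q" for S T
  proof
    show "\<Union>S \<inter> \<Union>T \<subseteq> \<Union>(S \<inter> T)"
    proof
      fix x assume "x \<in> \<Union>S \<inter> \<Union>T"
      then obtain c d where cd: "c \<in> S" "x \<in> c" "d \<in> T" "x \<in> d"
        by blast
      then have "c = d"
        using disj[of c d x] S T by (meson subsetD)
      with cd show "x \<in> \<Union>(S \<inter> T)" by blast
    qed
  qed blast
  have un: "\<Union>(\<Union>K) = (\<Union>U\<in>K. \<Union>U)" for K :: "'a set set set"
    by auto
  have "istopology (\<lambda>U. U \<subseteq> ?Q \<and> openin X (\<Union>U))"
    unfolding istopology_def
  proof (intro conjI allI impI)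
    fix S T assume "S \<subseteq> ?Q \<and> openin X (\<Union>S)" "T \<subseteq> ?Q \<and> openin X (\<Union>T)"
    then show "S \<inter> T \<subseteq> ?Q" "openin X (\<Union>(S \<inter> T))"
      using int[of S T] by auto
  next
    fix K assume "\<forall>U\<in>K. U \<subseteq> ?Q \<and> openin X (\<Union>U)"
    then show "\<Union>K \<subseteq> ?Q" "openin X (\<Union>(\<Union>K))"
      unfolding un by auto
  qed
  then show ?thesis
    by (simp add: quotient_topology_def)
qed

lemma topspace_quotient_topology [simp]:
  "topspace (quotient_topology X R) = topspace X // generated_equiv (topspace X) R"
proof -
  have "\<Union>(topspace X // generated_equiv (topspace X) R) = topspace X"
    by (rule Union_quotient[OF equiv_generated_equiv])
  then show ?thesis
    by (metis openin_quotient_topology openin_subset openin_topspace order_refl subset_antisym)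
qed


section \<open>Free groups and the descending central series\<close>

text \<open>The letter \<open>(i, True)\<close> is the generator \<open>x\<^sub>i\<close> and \<open>(i, False)\<close> is its inverse; an element
  of the free group is a class of words modulo free cancellation. The generators are indexed
  by \<open>0, \<dots>, n - 1\<close>.\<close>

definition words :: "nat \<Rightarrow> (nat \<times> bool) list set" where
  "words n = lists ({..<n} \<times> UNIV)"

definition word_equiv :: "nat \<Rightarrow> (nat \<times> bool) list rel" where
  "word_equiv n = generated_equiv (words n)
     {(u @ [(i, b), (i, \<not> b)] @ v, u @ v) | u v i b. True}"

definition free_group :: "nat \<Rightarrow> (nat \<times> bool) list set monoid" where
  "free_group n =
     \<lparr> carrier = words n // word_equiv n,
       monoid.mult = (\<lambda>U V. word_equiv n `` {u @ v | u v. u \<in> U \<and> v \<in> V}),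
       one = word_equiv n `` {[]} \<rparr>"

definition free_gen :: "nat \<Rightarrow> nat \<Rightarrow> (nat \<times> bool) list set" where
  "free_gen n i = word_equiv n `` {[(i, True)]}"

lemma equiv_word_equiv: "equiv (words n) (word_equiv n)"
  unfolding word_equiv_def by (rule equiv_generated_equiv)

lemma word_equiv_append:
  assumes "(u, u') \<in> word_equiv n" and a: "a \<in> words n" and c: "c \<in> words n"
  shows "(a @ u @ c, a @ u' @ c) \<in> word_equiv n"
proof -
  let ?C = "{(u @ [(i, b), (i, \<not> b)] @ v, u @ v) | u v i b. True} :: (nat \<times> bool) list rel"
  let ?r = "\<lambda>x y. x \<in> words n \<and> y \<in> words n \<and> (x, y) \<in> ?C"
  have mem: "a @ w @ c \<in> words n" if "w \<in> words n" for w
    using that a c by (auto simp: words_def)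
  have cong_step: "?r (a @ x @ c) (a @ y @ c)" if r: "?r x y" for x y
  proof -
    from r have x: "x \<in> words n" and y: "y \<in> words n" by simp_all
    from r obtain p v i b where "x = p @ [(i, b), (i, \<not> b)] @ v" "y = p @ v" by auto
    then have "a @ x @ c = (a @ p) @ [(i, b), (i, \<not> b)] @ (v @ c)" "a @ y @ c = (a @ p) @ (v @ c)"
      by auto
    then have "(a @ x @ c, a @ y @ c) \<in> ?C" by blast
    with mem[OF x] mem[OF y] show ?thesis by simp
  qed
  have *: "equivclp ?r u u'" and uv: "u \<in> words n" "u' \<in> words n"
    using assms(1) by (simp_all add: word_equiv_def generated_equiv_def)
  from *  have "equivclp ?r (a @ u @ c) (a @ u' @ c)"
  proof (induction rule: equivclp_induct)
    case base
    show ?case by simp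
  next
    case (step y z)
    from step.hyps(2) have "?r (a @ y @ c) (a @ z @ c) \<or> ?r (a @ z @ c) (a @ y @ c)"
      by (elim disjE) (rule disjI1, erule cong_step, rule disjI2, erule cong_step)
    then show ?case
      by (rule equivclp_into_equivclp[OF step.IH])
  qed
  with uv mem show ?thesis
    by (simp add: word_equiv_def generated_equiv_def)
qed

lemma free_group_mult:
  assumes "u \<in> words n" "v \<in> words n"
  shows "word_equiv n `` {u} \<otimes>\<^bsub>free_group n\<^esub> word_equiv n `` {v} = word_equiv n `` {u @ v}"
proof -
  note E = equiv_word_equiv[of n]
  have tr: "trans (word_equiv n)"
    using E by (simp add: equiv_def)
  have *: "(u @ v, u' @ v') \<in> word_equiv n"
    if u': "(u, u') \<in> word_equiv n" and v': "(v, v') \<in> word_equiv n" for u' v'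
  proof -
    have "u' \<in> words n"
      using u' by (simp add: word_equiv_def generated_equiv_def)
    then have "(u' @ v, u' @ v') \<in> word_equiv n"
      using word_equiv_append[OF v', of u' "[]"] by (simp add: words_def)
    moreover have "(u @ v, u' @ v) \<in> word_equiv n"
      using word_equiv_append[OF u', of "[]" v] assms by (simp add: words_def)
    ultimately show ?thesis
      using transD[OF tr] by blast
  qed
  have r: "(u, u) \<in> word_equiv n" "(v, v) \<in> word_equiv n"
    using assms E by (auto simp: equiv_def refl_on_def)
  have "word_equiv n `` {x @ y | x y. x \<in> word_equiv n `` {u} \<and> y \<in> word_equiv n `` {v}}
        = word_equiv n `` {u @ v}" (is "?L = ?R")
  proof
    show "?L \<subseteq> ?R"
    proof
      fix w assume "w \<in> ?L"
      then obtain x y where xy: "(u, x) \<in> word_equiv n" "(v, y) \<in> word_equiv n"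
          "(x @ y, w) \<in> word_equiv n"
        by blast
      show "w \<in> ?R"
        using transD[OF tr *[OF xy(1,2)] xy(3)] by simp
    qed
    show "?R \<subseteq> ?L"
      using r by blast
  qed
  then show ?thesis
    by (simp add: free_group_def)
qed

lemma group_free_group: "group (free_group n)"
proof (rule groupI)
  note E = equiv_word_equiv[of n]
  have tr: "trans (word_equiv n)"
    using E by (simp add: equiv_def)
  have carr: "\<exists>u \<in> words n. x = word_equiv n `` {u}" if "x \<in> carrier (free_group n)" for x
    using that by (auto simp: free_group_def elim: quotientE)
  have cl: "word_equiv n `` {u} \<in> carrier (free_group n)" if "u \<in> words n" for u
    using that by (simp add: free_group_def quotientI)
  have one: "\<one>\<^bsub>free_group n\<^esub> = word_equiv n `` {[]}"
    by (simp add: free_group_def)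
  have nil: "[] \<in> words n" and app: "\<And>u v. u \<in> words n \<Longrightarrow> v \<in> words n \<Longrightarrow> u @ v \<in> words n"
    by (auto simp: words_def)
  show "\<one>\<^bsub>free_group n\<^esub> \<in> carrier (free_group n)"
    using cl[OF nil] one by simp
  fix x assume "x \<in> carrier (free_group n)"
  then obtain u where u: "u \<in> words n" "x = word_equiv n `` {u}"
    using carr by blast
  show "\<one>\<^bsub>free_group n\<^esub> \<otimes>\<^bsub>free_group n\<^esub> x = x"
    using free_group_mult[OF nil u(1)] one u by simp
  have "\<exists>v \<in> words n. (v @ u, []) \<in> word_equiv n"
    using u(1)
  proof (induction u)
    case Nil
    then show ?case
      using nil E by (auto simp: equiv_def refl_on_def intro!: bexI[of _ "[]"])
  next
    case (Cons l u)
    obtain i b where l: "l = (i, b)" by fastforce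
    have u: "u \<in> words n" and i: "i < n"
      using Cons.prems l by (auto simp: words_def)
    then obtain v where v: "v \<in> words n" "(v @ u, []) \<in> word_equiv n"
      using Cons.IH by blast
    let ?v = "v @ [(i, \<not> b)]"
    have v': "?v \<in> words n" "?v @ l # u \<in> words n" "v @ u \<in> words n"
      using v(1) u i l by (auto simp: words_def)
    let ?C = "{(u @ [(i, b), (i, \<not> b)] @ v, u @ v) | u v i b. True} :: (nat \<times> bool) list rel"
    have "?v @ l # u = v @ [(i, \<not> b), (i, \<not> \<not> b)] @ u"
      by (simp add: l)
    then have "(?v @ l # u, v @ u) \<in> ?C"
      by blast
    with v' have "(?v @ l # u, v @ u) \<in> word_equiv n"
      unfolding word_equiv_def generated_equiv_def by (simp add: r_into_equivclp)
    then have "(?v @ l # u, []) \<in> word_equiv n"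
      by (rule transD[OF tr _ v(2)])
    with v'(1) show ?case by blast
  qed
  then obtain v where v: "v \<in> words n" "(v @ u, []) \<in> word_equiv n" by blast
  then have "word_equiv n `` {v} \<otimes>\<^bsub>free_group n\<^esub> x = \<one>\<^bsub>free_group n\<^esub>"
    using free_group_mult[OF v(1) u(1)] u(2) one equiv_class_eq[OF E v(2)] by simp
  then show "\<exists>y \<in> carrier (free_group n). y \<otimes>\<^bsub>free_group n\<^esub> x = \<one>\<^bsub>free_group n\<^esub>"
    using cl[OF v(1)] by blast
  fix y assume "y \<in> carrier (free_group n)"
  then obtain v where v: "v \<in> words n" "y = word_equiv n `` {v}"
    using carr by blast
  show "x \<otimes>\<^bsub>free_group n\<^esub> y \<in> carrier (free_group n)"
    using free_group_mult[OF u(1) v(1)] u v cl app by simp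
  fix z assume "z \<in> carrier (free_group n)"
  then obtain w where w: "w \<in> words n" "z = word_equiv n `` {w}"
    using carr by blast
  show "x \<otimes>\<^bsub>free_group n\<^esub> y \<otimes>\<^bsub>free_group n\<^esub> z
      = x \<otimes>\<^bsub>free_group n\<^esub> (y \<otimes>\<^bsub>free_group n\<^esub> z)"
    using u v w by (simp add: free_group_mult app)
qed

definition commutator_subgroup ::
    "('a, 'b) monoid_scheme \<Rightarrow> 'a set \<Rightarrow> 'a set \<Rightarrow> 'a set" where
  "commutator_subgroup G H K =
     generate G {h \<otimes>\<^bsub>G\<^esub> k \<otimes>\<^bsub>G\<^esub> inv\<^bsub>G\<^esub> h \<otimes>\<^bsub>G\<^esub> inv\<^bsub>G\<^esub> k | h k. h \<in> H \<and> k \<in> K}"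

primrec lower_central :: "('a, 'b) monoid_scheme \<Rightarrow> nat \<Rightarrow> 'a set" where
  "lower_central G 0 = carrier G"
| "lower_central G (Suc i) = commutator_subgroup G (lower_central G i) (carrier G)"

text \<open>The series is indexed from \<open>1\<close>, so that \<open>Gamma 1 G = carrier G\<close> and
  \<open>Gamma 2 G\<close> is the commutator subgroup; the value at \<open>0\<close> is irrelevant.\<close>

definition Gamma :: "enat \<Rightarrow> ('a, 'b) monoid_scheme \<Rightarrow> 'a set" where
  "Gamma q G = (case q of enat i \<Rightarrow> lower_central G (i - 1) | \<infinity> \<Rightarrow> {\<one>\<^bsub>G\<^esub>})"


section \<open>Simplicial spaces and geometric realization\<close>

text \<open>\<open>face X n i\<close> is \<open>d\<^sub>i : X\<^sub>n \<rightarrow> X\<^sub>n\<^sub>-\<^sub>1\<close> and \<open>degen X n j\<close> is \<open>s\<^sub>j : X\<^sub>n \<rightarrow> X\<^sub>n\<^sub>+\<^sub>1\<close>.\<close>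

record 'a simplicial_space =
  level :: "nat \<Rightarrow> 'a topology"
  face :: "nat \<Rightarrow> nat \<Rightarrow> 'a \<Rightarrow> 'a"
  degen :: "nat \<Rightarrow> nat \<Rightarrow> 'a \<Rightarrow> 'a"

text \<open>The dual of \<^const>\<open>simplical_face\<close>: the map induced by the monotone surjection that takes
  the value \<open>j\<close> twice.\<close>

definition simplicial_collapse :: "nat \<Rightarrow> (nat \<Rightarrow> real) \<Rightarrow> nat \<Rightarrow> real" where
  "simplicial_collapse j t =
     (\<lambda>i. if i < j then t i else if i = j then t j + t (Suc j) else t (Suc i))"

type_synonym 'a point = "nat \<times> 'a \<times> (nat \<Rightarrow> real)"

definition realization_sum :: "'a simplicial_space \<Rightarrow> 'a point topology" where
  "realization_sum X =
     sum_topology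
       (\<lambda>n. prod_topology (level X n) (subtopology (powertop_real UNIV) (standard_simplex n)))
       UNIV"

definition realization_glue :: "'a simplicial_space \<Rightarrow> 'a point rel" where
  "realization_glue X =
     {((n, face X (Suc n) i x, t), (Suc n, x, simplical_face i t)) | n i x t.
        i \<le> Suc n \<and> x \<in> topspace (level X (Suc n)) \<and> t \<in> standard_simplex n} \<union>
     {((Suc n, degen X n j x, t), (n, x, simplicial_collapse j t)) | n j x t.
        j \<le> n \<and> x \<in> topspace (level X n) \<and> t \<in> standard_simplex (Suc n)}"

definition realization :: "'a simplicial_space \<Rightarrow> 'a point set topology" where
  "realization X = quotient_topology (realization_sum X) (realization_glue X)"

text \<open>The map of realizations induced by a simplicial map \<open>\<phi>\<close> into \<open>Y\<close>, sending the class of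
  \<open>(n, x, t)\<close> to the class of \<open>(n, \<phi>\<^sub>n x, t)\<close>. The union over all representatives is
  a single class, as \<open>\<phi>\<close> is simplicial.\<close>

definition realization_map ::
    "'b simplicial_space \<Rightarrow> (nat \<Rightarrow> 'a \<Rightarrow> 'b) \<Rightarrow> 'a point set \<Rightarrow> 'b point set" where
  "realization_map Y \<phi> c =
     generated_equiv (topspace (realization_sum Y)) (realization_glue Y) ``
       ((\<lambda>(n, x, t). (n, \<phi> n x, t)) ` c)"


section \<open>The spaces $B(q,G)$\<close>

text \<open>\<open>Hom(F\<^sub>n/\<Gamma>\<^sup>q, G)\<close> as a set of \<open>n\<close>-tuples, written as lists.\<close>

definition Hom_tuples :: "nat \<Rightarrow> enat \<Rightarrow> ('a, 'b) monoid_scheme \<Rightarrow> 'a list set" where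
  "Hom_tuples n q G =
     {map (\<lambda>i. \<phi> (free_gen n i)) [0..<n] | \<phi>.
        \<phi> \<in> hom (free_group n) G \<and> (\<forall>w \<in> Gamma q (free_group n). \<phi> w = \<one>\<^bsub>G\<^esub>)}"

definition bar_face :: "('a, 'b) monoid_scheme \<Rightarrow> nat \<Rightarrow> nat \<Rightarrow> 'a list \<Rightarrow> 'a list" where
  "bar_face G n i gs =
     (if i = 0 then tl gs
      else if i = n then butlast gs
      else take (i - 1) gs @ [gs ! (i - 1) \<otimes>\<^bsub>G\<^esub> gs ! i] @ drop (i + 1) gs)"

definition bar_degen :: "('a, 'b) monoid_scheme \<Rightarrow> nat \<Rightarrow> nat \<Rightarrow> 'a list \<Rightarrow> 'a list" where
  "bar_degen G n j gs = take j gs @ [\<one>\<^bsub>G\<^esub>] @ drop j gs"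

text \<open>\<open>G\<close> carries the discrete topology here, which is the relevant one for finite groups.\<close>

definition B_simp :: "enat \<Rightarrow> ('a, 'b) monoid_scheme \<Rightarrow> 'a list simplicial_space" where
  "B_simp q G =
     \<lparr> level = (\<lambda>n. discrete_topology (Hom_tuples n q G)),
       face = bar_face G,
       degen = bar_degen G \<rparr>"

definition B_space :: "enat \<Rightarrow> ('a, 'b) monoid_scheme \<Rightarrow> 'a list point set topology" where
  "B_space q G = realization (B_simp q G)"

text \<open>For a subgroup \<open>A\<close> of \<open>G\<close>, the space \<open>BA\<close> is \<open>B(\<infinity>, A)\<close>.\<close>

definition B_sub :: "('a, 'b) monoid_scheme \<Rightarrow> 'a set \<Rightarrow> 'a list point set topology" where
  "B_sub G A = B_space \<infinity> (G\<lparr>carrier := A\<rparr>)"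

text \<open>The map into \<open>B(q, G)\<close> induced by a levelwise inclusion of simplicial spaces; it is used
  for \<open>BA \<subseteq> B(q, G)\<close> and (with \<open>q = \<infinity>\<close>) for \<open>BA \<subseteq> BA'\<close>.\<close>

definition B_incl ::
    "enat \<Rightarrow> ('a, 'b) monoid_scheme \<Rightarrow> 'a list point set \<Rightarrow> 'a list point set" where
  "B_incl q G = realization_map (B_simp q G) (\<lambda>n gs. gs)"

definition nilpotent_subgroups :: "enat \<Rightarrow> ('a, 'b) monoid_scheme \<Rightarrow> 'a set set" where
  "nilpotent_subgroups q G =
     {A. subgroup A G \<and> Gamma q (G\<lparr>carrier := A\<rparr>) = {\<one>\<^bsub>G\<^esub>}}"


section \<open>Colimits of spaces over a poset\<close>

text \<open>The colimit in topological spaces of the diagram \<open>D\<close> with transition maps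
  \<open>f i j : D i \<rightarrow> D j\<close> for \<open>i \<le> j\<close>, as the quotient of the disjoint union by the equivalence
  relation generated by \<open>x \<sim> f i j x\<close>.\<close>

definition colim_rel ::
    "'i set \<Rightarrow> ('i \<Rightarrow> 'i \<Rightarrow> bool) \<Rightarrow> ('i \<Rightarrow> 'x topology) \<Rightarrow> ('i \<Rightarrow> 'i \<Rightarrow> 'x \<Rightarrow> 'x) \<Rightarrow>
     ('i \<times> 'x) rel" where
  "colim_rel I r D f =
     {((i, x), (j, f i j x)) | i j x. i \<in> I \<and> j \<in> I \<and> r i j \<and> x \<in> topspace (D i)}"

definition colim ::
    "'i set \<Rightarrow> ('i \<Rightarrow> 'i \<Rightarrow> bool) \<Rightarrow> ('i \<Rightarrow> 'x topology) \<Rightarrow> ('i \<Rightarrow> 'i \<Rightarrow> 'x \<Rightarrow> 'x) \<Rightarrow>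
     ('i \<times> 'x) set topology" where
  "colim I r D f = quotient_topology (sum_topology D I) (colim_rel I r D f)"

definition colim_inj ::
    "'i set \<Rightarrow> ('i \<Rightarrow> 'i \<Rightarrow> bool) \<Rightarrow> ('i \<Rightarrow> 'x topology) \<Rightarrow> ('i \<Rightarrow> 'i \<Rightarrow> 'x \<Rightarrow> 'x) \<Rightarrow>
     'i \<Rightarrow> 'x \<Rightarrow> ('i \<times> 'x) set" where
  "colim_inj I r D f i x =
     generated_equiv (topspace (sum_topology D I)) (colim_rel I r D f) `` {(i, x)}"

text \<open>The diagram \<open>A \<mapsto> BA\<close> over the poset of subgroups of class less than \<open>q\<close>.\<close>

definition colim_BA ::
    "enat \<Rightarrow> ('a, 'b) monoid_scheme \<Rightarrow> ('a set \<times> 'a list point set) set topology" where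
  "colim_BA q G = colim (nilpotent_subgroups q G) (\<subseteq>) (B_sub G)
     (\<lambda>A A'. B_incl \<infinity> (G\<lparr>carrier := A'\<rparr>))"

definition colim_BA_inj ::
    "enat \<Rightarrow> ('a, 'b) monoid_scheme \<Rightarrow> 'a set \<Rightarrow> 'a list point set \<Rightarrow>
     ('a set \<times> 'a list point set) set" where
  "colim_BA_inj q G = colim_inj (nilpotent_subgroups q G) (\<subseteq>) (B_sub G)
     (\<lambda>A A'. B_incl \<infinity> (G\<lparr>carrier := A'\<rparr>))"

end

theory Submission
  imports Defs
begin

text \<open>
  The theorem comes from two facts, one about groups and one about topology.

  Algebraically, an \<open>n\<close>-tuple of elements of \<open>G\<close> is the image of the generators under a homomorphism
  \<open>\<phi> : F\<^sub>n \<rightarrow> G\<close>, and a homomorphism that is onto a subgroup \<open>A\<close> carries \<open>\<Gamma>\<^sup>q(F\<^sub>n)\<close> onto \<open>\<Gamma>\<^sup>q(A)\<close>. So \<open>\<phi>\<close>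
  kills \<open>\<Gamma>\<^sup>q(F\<^sub>n)\<close> exactly if the entries of the tuple lie in some subgroup \<open>A\<close> of class less than \<open>q\<close>:
  \<open>B\<^sub>n(q, G)\<close> is the union of the sets \<open>A\<^sup>n\<close> with \<open>A \<in> N\<^sub>q(G)\<close> (\<open>Hom_tuples_eq_Union\<close>). As \<open>N\<^sub>q(G)\<close> is closed
  under intersection, and \<open>A\<^sup>n \<inter> A'\<^sup>n = (A \<inter> A')\<^sup>n\<close>, this union is a colimit of sets, level by level.

  Topologically, realization and colimit are both quotients of disjoint unions, so maps out of
  either are determined by compatible families of continuous maps. The inclusions \<open>BA \<rightarrow> B(q, G)\<close>
  thus give a continuous map \<open>h\<close> from the colimit to \<open>B(q, G)\<close> (\<open>colim_BA_to_B_space\<close>). In the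
  other direction, send the point \<open>(g\<^sub>1, \<dots>, g\<^sub>n; t)\<close> of a simplex to the point with the same
  name in \<open>BA\<close>, for any \<open>A \<in> N\<^sub>q(G)\<close> that contains the \<open>g\<^sub>i\<close>, and from there to the colimit. The
  choice of \<open>A\<close> is immaterial, because two choices agree through their intersection
  (\<open>colim_BA_inj_eq\<close>). The gluing relations are respected, because the faces and degeneracies of a
  tuple in \<open>A\<close> stay in \<open>A\<close> (\<open>bar_construction_glue\<close>). Continuity can be tested on one simplex at a
  time, as the levels are discrete; there a single \<open>A\<close> serves the whole simplex. The resulting
  map (\<open>B_space_to_colim_BA\<close>) is inverse to \<open>h\<close>, as one reads off from representatives.
\<close>

section \<open>Lower central series and homomorphisms\<close>

lemma commutator_subgroup_mono:
  assumes "group G" "H \<subseteq> H'" "K \<subseteq> K'"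
  shows "commutator_subgroup G H K \<subseteq> commutator_subgroup G H' K'"
  unfolding commutator_subgroup_def
  by (rule group.mono_generate[OF assms(1)]) (use assms(2,3) in blast)

lemma (in group) lower_central_subset_carrier: "lower_central G i \<subseteq> carrier G"
proof (induction i)
  case (Suc i)
  then have "{h \<otimes> k \<otimes> inv h \<otimes> inv k | h k. h \<in> lower_central G i \<and> k \<in> carrier G} \<subseteq> carrier G"
    by auto
  then show ?case
    by (auto simp: commutator_subgroup_def intro: generate_in_carrier)
qed simp

text \<open>A homomorphism maps commutators to commutators of the images, and every commutator of images
  is hit, so the generating sets correspond.\<close>

lemma (in group_hom) image_commutator_subgroup:
  assumes K: "K \<subseteq> carrier G" and L: "L \<subseteq> carrier G"
  shows "h ` commutator_subgroup G K L = commutator_subgroup H (h ` K) (h ` L)"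
proof -
  let ?C = "{k \<otimes> l \<otimes> inv k \<otimes> inv l | k l. k \<in> K \<and> l \<in> L}"
  let ?D = "{k \<otimes>\<^bsub>H\<^esub> l \<otimes>\<^bsub>H\<^esub> inv\<^bsub>H\<^esub> k \<otimes>\<^bsub>H\<^esub> inv\<^bsub>H\<^esub> l | k l. k \<in> h ` K \<and> l \<in> h ` L}"
  have hc: "h (k \<otimes> l \<otimes> inv k \<otimes> inv l)
      = h k \<otimes>\<^bsub>H\<^esub> h l \<otimes>\<^bsub>H\<^esub> inv\<^bsub>H\<^esub> (h k) \<otimes>\<^bsub>H\<^esub> inv\<^bsub>H\<^esub> (h l)" if "k \<in> K" "l \<in> L" for k l
    using that K L by (simp add: subset_iff)
  have "h ` ?C = ?D"
  proof
    show "h ` ?C \<subseteq> ?D"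
      using hc by (smt (verit, del_insts) image_subset_iff mem_Collect_eq imageI)
    show "?D \<subseteq> h ` ?C"
    proof
      fix d assume "d \<in> ?D"
      then obtain k l where kl: "k \<in> K" "l \<in> L"
          and d: "d = h k \<otimes>\<^bsub>H\<^esub> h l \<otimes>\<^bsub>H\<^esub> inv\<^bsub>H\<^esub> (h k) \<otimes>\<^bsub>H\<^esub> inv\<^bsub>H\<^esub> (h l)"
        by auto
      show "d \<in> h ` ?C"
        unfolding d hc[OF kl, symmetric] by (rule imageI) (use kl in blast)
    qed
  qed
  moreover have "?C \<subseteq> carrier G"
    using K L by (auto simp: subset_iff)
  ultimately show ?thesis
    unfolding commutator_subgroup_def using generate_img[of ?C] by simp
qed

lemma (in group_hom) image_lower_central_subset:
  "h ` lower_central G i \<subseteq> lower_central H i"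
proof (induction i)
  case (Suc i)
  have "h ` carrier G \<subseteq> carrier H"
    by auto
  with Suc show ?case
    using image_commutator_subgroup[OF G.lower_central_subset_carrier order_refl]
      commutator_subgroup_mono[OF H.is_group] by simp
qed auto

text \<open>Surjectivity enters through the factor \<open>carrier G\<close> in each commutator: without it, the image
  of that factor is smaller than \<open>carrier H\<close>, and only an inclusion remains.\<close>

lemma (in group_hom) image_lower_central_surj:
  assumes "h ` carrier G = carrier H"
  shows "h ` lower_central G i = lower_central H i"
  by (induction i)
    (simp_all add: assms image_commutator_subgroup[OF G.lower_central_subset_carrier])

lemma (in group_hom) image_Gamma_subset: "h ` Gamma q G \<subseteq> Gamma q H"
  using image_lower_central_subset by (cases q) (auto simp: Gamma_def)

lemma (in group_hom) image_Gamma_surj: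
  assumes "h ` carrier G = carrier H"
  shows "h ` Gamma q G = Gamma q H"
  using image_lower_central_surj[OF assms] by (cases q) (auto simp: Gamma_def)

lemma (in group) one_in_Gamma: "\<one> \<in> Gamma q G"
proof (cases q)
  case (enat i)
  have "\<one> \<in> lower_central G j" for j
    by (cases j) (simp_all add: commutator_subgroup_def generate.one)
  then show ?thesis
    by (simp add: Gamma_def enat)
qed (simp add: Gamma_def)

text \<open>The inclusion \<open>B \<rightarrow> A\<close> is a homomorphism, so it maps \<open>\<Gamma>\<^sup>q(B)\<close> into \<open>\<Gamma>\<^sup>q(A)\<close>.\<close>

lemma (in group) nilpotent_subgroups_downward_closed:
  assumes A: "A \<in> nilpotent_subgroups q G" and B: "subgroup B G" and BA: "B \<subseteq> A"
  shows "B \<in> nilpotent_subgroups q G"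
proof -
  have A': "subgroup A G" "Gamma q (G\<lparr>carrier := A\<rparr>) = {\<one>}"
    using A by (auto simp: nilpotent_subgroups_def)
  have gB: "group (G\<lparr>carrier := B\<rparr>)" and gA: "group (G\<lparr>carrier := A\<rparr>)"
    using B A' by (simp_all add: subgroup_imp_group)
  interpret B: group "G\<lparr>carrier := B\<rparr>" by (fact gB)
  interpret i: group_hom "G\<lparr>carrier := B\<rparr>" "G\<lparr>carrier := A\<rparr>" "\<lambda>x. x"
    using gA gB BA by (auto simp: group_hom_def group_hom_axioms_def hom_def)
  show ?thesis
    using i.image_Gamma_subset[of q] A' B B.one_in_Gamma[of q]
    by (auto simp: nilpotent_subgroups_def)
qed

lemma (in group) nilpotent_subgroups_Int:
  assumes "A \<in> nilpotent_subgroups q G" "B \<in> nilpotent_subgroups q G"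
  shows "A \<inter> B \<in> nilpotent_subgroups q G"
  using assms
  by (intro nilpotent_subgroups_downward_closed[OF assms(1)])
    (auto simp: nilpotent_subgroups_def intro: subgroups_Inter_pair)


section \<open>Homomorphisms out of free groups\<close>

text \<open>Words are evaluated at \<open>gs\<close> by sending the letter \<open>x\<^sub>i\<close> to \<open>gs ! i\<close>. This is the candidate for the
  homomorphism from the free group that takes prescribed values on the generators.\<close>

definition eval_letter :: "('a, 'b) monoid_scheme \<Rightarrow> 'a list \<Rightarrow> nat \<times> bool \<Rightarrow> 'a" where
  "eval_letter G gs l = (if snd l then gs ! fst l else inv\<^bsub>G\<^esub> (gs ! fst l))"

definition eval_word :: "('a, 'b) monoid_scheme \<Rightarrow> 'a list \<Rightarrow> (nat \<times> bool) list \<Rightarrow> 'a" where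
  "eval_word G gs w = foldr (\<lambda>l a. eval_letter G gs l \<otimes>\<^bsub>G\<^esub> a) w \<one>\<^bsub>G\<^esub>"

context group
begin

lemma eval_letter_closed:
  assumes "set gs \<subseteq> carrier G" "fst l < length gs"
  shows "eval_letter G gs l \<in> carrier G"
proof -
  have "gs ! fst l \<in> carrier G"
    using assms nth_mem by blast
  then show ?thesis by (simp add: eval_letter_def)
qed

lemma eval_word_closed:
  assumes "set gs \<subseteq> carrier G" "w \<in> words (length gs)"
  shows "eval_word G gs w \<in> carrier G"
  using assms(2)
  by (induction w) (auto simp: eval_word_def words_def eval_letter_closed[OF assms(1)])

lemma eval_word_append:
  assumes gs: "set gs \<subseteq> carrier G" and u: "u \<in> words (length gs)" and v: "v \<in> words (length gs)"
  shows "eval_word G gs (u @ v) = eval_word G gs u \<otimes> eval_word G gs v"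
  using u
proof (induction u)
  case Nil
  then show ?case
    using eval_word_closed[OF gs v] by (simp add: eval_word_def)
next
  case (Cons l u)
  then have "fst l < length gs" "u \<in> words (length gs)"
    by (auto simp: words_def)
  with Cons show ?case
    using eval_word_closed[OF gs v] eval_word_closed[OF gs, of u] eval_letter_closed[OF gs, of l]
    by (simp add: eval_word_def m_assoc)
qed

lemma eval_word_cancel:
  assumes gs: "set gs \<subseteq> carrier G" and w: "u @ [(i, b), (i, \<not> b)] @ v \<in> words (length gs)"
  shows "eval_word G gs (u @ [(i, b), (i, \<not> b)] @ v) = eval_word G gs (u @ v)"
proof -
  have uv: "u \<in> words (length gs)" "v \<in> words (length gs)" and i: "i < length gs"
      and m: "[(i, b), (i, \<not> b)] @ v \<in> words (length gs)"
    using w by (auto simp: words_def)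
  have "gs ! i \<in> carrier G"
    using gs i nth_mem by blast
  moreover note eval_word_closed[OF gs uv(2)]
  ultimately have "eval_word G gs ([(i, b), (i, \<not> b)] @ v) = eval_word G gs v"
    by (simp add: eval_word_def eval_letter_def inv_solve_left' r_inv l_inv flip: m_assoc)
  then show ?thesis
    using eval_word_append[OF gs uv(1) m] eval_word_append[OF gs uv] by simp
qed

lemma eval_word_respects:
  assumes gs: "set gs \<subseteq> carrier G" and uv: "(u, v) \<in> word_equiv (length gs)"
  shows "eval_word G gs u = eval_word G gs v"
proof -
  let ?n = "length gs"
  have "equivclp (\<lambda>x y. x \<in> words ?n \<and> y \<in> words ?n \<and>
      (x, y) \<in> {(u @ [(i, b), (i, \<not> b)] @ v, u @ v) | u v i b. True}) u v"
    using uv by (simp add: word_equiv_def generated_equiv_def)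
  then show ?thesis
  proof (induction rule: equivclp_induct)
    case (step y z)
    then show ?case
      using eval_word_cancel[OF gs] by fastforce
  qed simp
qed

text \<open>The universal property of the free group: evaluation of words does not change under free
  cancellation, so it descends to classes of words.\<close>

lemma free_group_lift:
  assumes gs: "set gs \<subseteq> carrier G"
  obtains \<phi> where "\<phi> \<in> hom (free_group (length gs)) G"
    "\<And>i. i < length gs \<Longrightarrow> \<phi> (free_gen (length gs) i) = gs ! i"
proof
  let ?n = "length gs"
  \<comment> \<open>Any representative of the class gives the same value.\<close>
  define \<phi> where "\<phi> c = eval_word G gs (SOME w. w \<in> c)" for c
  have \<phi>: "\<phi> (word_equiv ?n `` {w}) = eval_word G gs w" if "w \<in> words ?n" for w
  proof -
    have "w \<in> word_equiv ?n `` {w}"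
      using that equiv_word_equiv by (auto simp: equiv_def refl_on_def)
    then have "(w, SOME v. v \<in> word_equiv ?n `` {w}) \<in> word_equiv ?n"
      by (metis Image_singleton_iff someI)
    then show ?thesis
      unfolding \<phi>_def using eval_word_respects[OF gs] by simp
  qed
  have carr: "\<exists>u \<in> words ?n. x = word_equiv ?n `` {u}" if "x \<in> carrier (free_group ?n)" for x
    using that by (auto simp: free_group_def elim: quotientE)
  show "\<phi> \<in> hom (free_group ?n) G"
  proof (rule homI)
    fix x assume "x \<in> carrier (free_group ?n)"
    then obtain u where u: "u \<in> words ?n" "x = word_equiv ?n `` {u}"
      using carr by blast
    show "\<phi> x \<in> carrier G"
      using \<phi> u eval_word_closed[OF gs] by simp
    fix y assume "y \<in> carrier (free_group ?n)"
    then obtain v where v: "v \<in> words ?n" "y = word_equiv ?n `` {v}"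
      using carr by blast
    have "u @ v \<in> words ?n"
      using u v by (auto simp: words_def)
    then show "\<phi> (x \<otimes>\<^bsub>free_group ?n\<^esub> y) = \<phi> x \<otimes> \<phi> y"
      using u v by (simp add: free_group_mult \<phi> eval_word_append[OF gs])
  qed
  fix i assume i: "i < ?n"
  then have "[(i, True)] \<in> words ?n" "gs ! i \<in> carrier G"
    using gs nth_mem by (auto simp: words_def)
  then show "\<phi> (free_gen ?n i) = gs ! i"
    by (simp add: free_gen_def \<phi> eval_word_def eval_letter_def)
qed

end

lemma free_gen_closed: "i < n \<Longrightarrow> free_gen n i \<in> carrier (free_group n)"
  by (auto simp: free_gen_def free_group_def words_def intro!: quotientI)

text \<open>With \<open>\<Gamma>\<^sup>\<infinity> = {1}\<close> there is no condition on the homomorphism, so every tuple occurs: this is the bar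
  construction of the whole group.\<close>

lemma (in group) Hom_tuples_infinity:
  "Hom_tuples n \<infinity> G = {gs. length gs = n \<and> set gs \<subseteq> carrier G}"
proof (intro equalityI subsetI)
  fix gs assume "gs \<in> Hom_tuples n \<infinity> G"
  then show "gs \<in> {gs. length gs = n \<and> set gs \<subseteq> carrier G}"
    using free_gen_closed by (fastforce simp: Hom_tuples_def hom_def)
next
  fix gs assume gs: "gs \<in> {gs. length gs = n \<and> set gs \<subseteq> carrier G}"
  then obtain \<phi> where \<phi>: "\<phi> \<in> hom (free_group n) G" "\<And>i. i < n \<Longrightarrow> \<phi> (free_gen n i) = gs ! i"
    using free_group_lift[of gs] by auto
  have "\<phi> \<one>\<^bsub>free_group n\<^esub> = \<one>"
    using hom_one[OF \<phi>(1) group_free_group] is_group by simp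
  moreover have "gs = map (\<lambda>i. \<phi> (free_gen n i)) [0..<n]"
    using \<phi>(2) gs by (intro nth_equalityI) auto
  ultimately show "gs \<in> Hom_tuples n \<infinity> G"
    using \<phi>(1) by (auto simp: Hom_tuples_def Gamma_def)
qed

text \<open>For a tuple coming from \<open>\<phi> : F\<^sub>n \<rightarrow> G\<close>, the image \<open>A\<close> of \<open>\<phi>\<close> contains the tuple and has
  \<open>\<Gamma>\<^sup>q(A) = \<phi>(\<Gamma>\<^sup>q(F\<^sub>n)) = {1}\<close>. Conversely, a tuple in such an \<open>A\<close> comes from a homomorphism into \<open>A\<close>, which
  maps \<open>\<Gamma>\<^sup>q(F\<^sub>n)\<close> into \<open>\<Gamma>\<^sup>q(A) = {1}\<close>.\<close>

lemma (in group) Hom_tuples_eq_Union: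
  "Hom_tuples n q G = {gs. length gs = n \<and> (\<exists>A \<in> nilpotent_subgroups q G. set gs \<subseteq> A)}"
proof (intro equalityI subsetI)
  {
    fix gs assume "gs \<in> Hom_tuples n q G"
    then obtain \<phi> where \<phi>: "\<phi> \<in> hom (free_group n) G" "\<forall>w \<in> Gamma q (free_group n). \<phi> w = \<one>"
        and gs: "gs = map (\<lambda>i. \<phi> (free_gen n i)) [0..<n]"
      by (auto simp: Hom_tuples_def)
    let ?A = "\<phi> ` carrier (free_group n)"
    interpret f: group_hom "free_group n" G \<phi>
      using \<phi>(1) group_free_group is_group by (simp add: group_hom_def group_hom_axioms_def)
    have A: "subgroup ?A G"
      by (rule f.img_is_subgroup)
    interpret r: group_hom "free_group n" "G\<lparr>carrier := ?A\<rparr>" \<phi>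
      using subgroup_imp_group[OF A] group_free_group
      by (simp add: group_hom_def group_hom_axioms_def hom_def)
    have "Gamma q (G\<lparr>carrier := ?A\<rparr>) = \<phi> ` Gamma q (free_group n)"
      using r.image_Gamma_surj by simp
    also have "\<dots> = {\<one>}"
      using \<phi>(2) group.one_in_Gamma[OF group_free_group] by fastforce
    finally have "?A \<in> nilpotent_subgroups q G"
      using A by (simp add: nilpotent_subgroups_def)
    moreover have "set gs \<subseteq> ?A"
      using gs free_gen_closed by auto
    ultimately show "gs \<in> {gs. length gs = n \<and> (\<exists>A \<in> nilpotent_subgroups q G. set gs \<subseteq> A)}"
      using gs by auto
  next
    fix gs assume "gs \<in> {gs. length gs = n \<and> (\<exists>A \<in> nilpotent_subgroups q G. set gs \<subseteq> A)}"
    then obtain A where n: "length gs = n" and gsA: "set gs \<subseteq> A"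
        and A: "subgroup A G" "Gamma q (G\<lparr>carrier := A\<rparr>) = {\<one>}"
      by (auto simp: nilpotent_subgroups_def)
    have gA: "group (G\<lparr>carrier := A\<rparr>)"
      by (rule subgroup_imp_group[OF A(1)])
    obtain \<phi> where \<phi>: "\<phi> \<in> hom (free_group n) (G\<lparr>carrier := A\<rparr>)"
        "\<And>i. i < n \<Longrightarrow> \<phi> (free_gen n i) = gs ! i"
      using group.free_group_lift[OF gA, of gs] gsA n by auto
    interpret f: group_hom "free_group n" "G\<lparr>carrier := A\<rparr>" \<phi>
      using \<phi>(1) gA group_free_group by (simp add: group_hom_def group_hom_axioms_def)
    have "\<phi> \<in> hom (free_group n) G"
      using \<phi>(1) subgroup.subset[OF A(1)] by (auto simp: hom_def)
    moreover have "\<forall>w \<in> Gamma q (free_group n). \<phi> w = \<one>"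
      using f.image_Gamma_subset[of q] A(2) by auto
    moreover have "gs = map (\<lambda>i. \<phi> (free_gen n i)) [0..<n]"
      using \<phi>(2) n by (intro nth_equalityI) auto
    ultimately show "gs \<in> Hom_tuples n q G"
      by (auto simp: Hom_tuples_def)
  }
qed


section \<open>Quotient topologies and colimits\<close>

abbreviation quotient_class :: "'a topology \<Rightarrow> 'a rel \<Rightarrow> 'a \<Rightarrow> 'a set" where
  "quotient_class X R x \<equiv> generated_equiv (topspace X) R `` {x}"

text \<open>Minimality of the generated equivalence relation.\<close>

lemma generated_equiv_subset:
  assumes "equiv S E" and "\<And>x y. (x, y) \<in> R \<Longrightarrow> x \<in> S \<Longrightarrow> y \<in> S \<Longrightarrow> (x, y) \<in> E"
  shows "generated_equiv S R \<subseteq> E"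
proof clarify
  fix x y assume "(x, y) \<in> generated_equiv S R"
  then have x: "x \<in> S" and xy: "equivclp (\<lambda>u v. u \<in> S \<and> v \<in> S \<and> (u, v) \<in> R) x y"
    by (auto simp: generated_equiv_def)
  from xy show "(x, y) \<in> E"
  proof (induction rule: equivclp_induct)
    case base
    then show ?case using x assms(1) by (auto simp: equiv_def refl_on_def)
  next
    case (step y z)
    then have "(y, z) \<in> E"
      using assms by (auto simp: equiv_def dest: symD)
    with step.IH show ?case
      using assms(1) by (auto simp: equiv_def dest: transD)
  qed
qed

lemma generated_equiv_respects:
  assumes xy: "(x, y) \<in> generated_equiv S R"
    and f: "\<And>u v. (u, v) \<in> R \<Longrightarrow> u \<in> S \<Longrightarrow> v \<in> S \<Longrightarrow> f u = f v"
  shows "f x = f y"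
proof -
  have "equiv S {(u, v). u \<in> S \<and> v \<in> S \<and> f u = f v}"
    by (rule equivI) (auto simp: refl_on_def sym_def trans_def)
  then have "generated_equiv S R \<subseteq> {(u, v). u \<in> S \<and> v \<in> S \<and> f u = f v}"
    by (rule generated_equiv_subset) (use f in auto)
  with xy show ?thesis by auto
qed

lemma quotient_class_eq:
  assumes "(x, y) \<in> R" "x \<in> topspace X" "y \<in> topspace X"
  shows "quotient_class X R x = quotient_class X R y"
  using assms by (intro equiv_class_eq[OF equiv_generated_equiv])
    (auto simp: generated_equiv_def intro: r_into_equivclp)

text \<open>The union of a set \<open>U\<close> of classes is the preimage of \<open>U\<close> under the projection, so the
  definition of the topology by unions of classes is the usual one.\<close>

lemma quotient_map_quotient_class:
  "quotient_map X (quotient_topology X R) (quotient_class X R)"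
proof -
  let ?E = "generated_equiv (topspace X) R"
  note E = equiv_generated_equiv[of "topspace X" R]
  have "\<Union>U = {x \<in> topspace X. ?E `` {x} \<in> U}" if "U \<subseteq> topspace X // ?E" for U
  proof (intro equalityI subsetI)
    fix x assume "x \<in> \<Union>U"
    then obtain c where c: "c \<in> U" "x \<in> c"
      by (rule UnionE)
    have c': "c \<in> topspace X // ?E"
      using that c(1) by (rule subsetD)
    then have "c = ?E `` {x}"
    proof (rule quotientE)
      fix y assume "c = ?E `` {y}"
      with c(2) show ?thesis
        using equiv_class_eq[OF E, of y x] by simp
    qed
    moreover have "x \<in> topspace X"
      using c(2) c' Union_quotient[OF E] UnionI by metis
    ultimately show "x \<in> {x \<in> topspace X. ?E `` {x} \<in> U}"
      using c by simp
  qed (use equiv_class_self[OF E] in auto)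
  then show ?thesis
    by (auto simp: quotient_map_def openin_quotient_topology quotient_def)
qed

lemma quotient_topology_cases:
  assumes "c \<in> topspace (quotient_topology X R)"
  obtains x where "x \<in> topspace X" "c = quotient_class X R x"
  using assms unfolding topspace_quotient_topology by (rule quotientE) (rule that)

text \<open>The universal property of the quotient; it suffices to check compatibility on the generating
  pairs.\<close>

lemma quotient_topology_induced_map:
  assumes "continuous_map X Y f"
    and "\<And>u v. (u, v) \<in> R \<Longrightarrow> u \<in> topspace X \<Longrightarrow> v \<in> topspace X \<Longrightarrow> f u = f v"
  obtains g where "continuous_map (quotient_topology X R) Y g"
    "\<And>x. x \<in> topspace X \<Longrightarrow> g (quotient_class X R x) = f x"
proof (rule quotient_map_lift_exists[OF quotient_map_quotient_class assms(1)])
  fix x y assume "x \<in> topspace X" "y \<in> topspace X" "quotient_class X R x = quotient_class X R y"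
  then have "(x, y) \<in> generated_equiv (topspace X) R"
    using eq_equiv_class[OF _ equiv_generated_equiv] by metis
  then show "f x = f y"
    by (rule generated_equiv_respects) (rule assms(2))
qed (use that in blast)

lemma continuous_map_from_sum_topology:
  assumes "\<And>i. i \<in> I \<Longrightarrow> continuous_map (D i) Y (\<lambda>x. f (i, x))"
  shows "continuous_map (sum_topology D I) Y f"
  unfolding continuous_map_def
proof (intro conjI allI impI)
  show "f \<in> topspace (sum_topology D I) \<rightarrow> topspace Y"
    using assms by (auto simp: continuous_map_def Pi_iff)
  fix U assume U: "openin Y U"
  have "openin (D i) {x. (i, x) \<in> {p \<in> topspace (sum_topology D I). f p \<in> U}}" if "i \<in> I" for i
    using openin_continuous_map_preimage[OF assms[OF that] U] that by simp
  then show "openin (sum_topology D I) {p \<in> topspace (sum_topology D I). f p \<in> U}"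
    unfolding openin_sum_topology by auto
qed

text \<open>A product with a discrete space is a disjoint union of copies of the other factor, so
  continuity can be checked copy by copy.\<close>

lemma continuous_map_from_discrete_prod:
  assumes "\<And>u. u \<in> U \<Longrightarrow> continuous_map T Y (\<lambda>t. f (u, t))"
  shows "continuous_map (prod_topology (discrete_topology U) T) Y f"
  unfolding continuous_map_def
proof (intro conjI allI impI)
  show "f \<in> topspace (prod_topology (discrete_topology U) T) \<rightarrow> topspace Y"
    using assms by (auto simp: continuous_map_def Pi_iff)
  fix V assume V: "openin Y V"
  show "openin (prod_topology (discrete_topology U) T)
      {p \<in> topspace (prod_topology (discrete_topology U) T). f p \<in> V}"
    unfolding openin_prod_topology_alt
  proof clarsimp
    fix u t assume ut: "u \<in> U" "t \<in> topspace T" "f (u, t) \<in> V"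
    have "openin T {t \<in> topspace T. f (u, t) \<in> V}"
      by (rule openin_continuous_map_preimage[OF assms[OF ut(1)] V])
    then show "\<exists>S\<subseteq>U. \<exists>W. openin T W \<and> u \<in> S \<and> t \<in> W \<and>
        S \<times> W \<subseteq> {p. p \<in> U \<times> topspace T \<and> f p \<in> V}"
      using ut by (intro exI[of _ "{u}"] conjI exI[of _ "{t \<in> topspace T. f (u, t) \<in> V}"]) auto
  qed
qed

lemma colim_inj_continuous:
  assumes "i \<in> I"
  shows "continuous_map (D i) (colim I r D f) (colim_inj I r D f i)"
  using continuous_map_compose[OF continuous_map_component_injection[OF assms]
      quotient_imp_continuous_map[OF quotient_map_quotient_class]]
  by (simp add: colim_def colim_inj_def[abs_def] o_def)

lemma colim_inj_transition:
  assumes "i \<in> I" "j \<in> I" "r i j" "x \<in> topspace (D i)" "f i j x \<in> topspace (D j)"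
  shows "colim_inj I r D f j (f i j x) = colim_inj I r D f i x"
  unfolding colim_inj_def
  by (rule quotient_class_eq[symmetric]) (use assms in \<open>auto simp: colim_rel_def\<close>)

lemma colim_cases:
  assumes "c \<in> topspace (colim I r D f)"
  obtains i x where "i \<in> I" "x \<in> topspace (D i)" "c = colim_inj I r D f i x"
  using assms unfolding colim_def
  by (rule quotient_topology_cases) (auto simp: colim_inj_def that)

text \<open>The universal property of the colimit.\<close>

lemma colim_induced_map:
  assumes "\<And>i. i \<in> I \<Longrightarrow> continuous_map (D i) Y (g i)"
    and "\<And>i j x. i \<in> I \<Longrightarrow> j \<in> I \<Longrightarrow> r i j \<Longrightarrow> x \<in> topspace (D i) \<Longrightarrow> g j (f i j x) = g i x"
  obtains h where "continuous_map (colim I r D f) Y h"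
    "\<And>i x. i \<in> I \<Longrightarrow> x \<in> topspace (D i) \<Longrightarrow> h (colim_inj I r D f i x) = g i x"
proof -
  let ?g = "\<lambda>(i, x). g i x"
  have "continuous_map (sum_topology D I) Y ?g"
    by (rule continuous_map_from_sum_topology) (simp add: assms(1))
  moreover have "?g u = ?g v" if "(u, v) \<in> colim_rel I r D f" for u v
    using that assms(2) by (auto simp: colim_rel_def)
  ultimately obtain h where "continuous_map (colim I r D f) Y h"
      "\<And>p. p \<in> topspace (sum_topology D I) \<Longrightarrow>
        h (quotient_class (sum_topology D I) (colim_rel I r D f) p) = ?g p"
    unfolding colim_def by (rule quotient_topology_induced_map) blast+
  then show thesis
    by (intro that[of h]) (auto simp: colim_inj_def)
qed


section \<open>Geometric realization\<close>

definition realization_class :: "'a simplicial_space \<Rightarrow> 'a point \<Rightarrow> 'a point set" where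
  "realization_class X = quotient_class (realization_sum X) (realization_glue X)"

lemma topspace_realization_sum:
  "topspace (realization_sum X) =
     {(n, x, t) | n x t. x \<in> topspace (level X n) \<and> t \<in> standard_simplex n}"
  by (auto simp: realization_sum_def)

lemma realization_class_continuous:
  "continuous_map (realization_sum X) (realization X) (realization_class X)"
  unfolding realization_def realization_class_def
  by (rule quotient_imp_continuous_map[OF quotient_map_quotient_class])

lemma realization_cases:
  assumes "c \<in> topspace (realization X)"
  obtains n x t where "x \<in> topspace (level X n)" "t \<in> standard_simplex n"
    "c = realization_class X (n, x, t)"
proof -
  obtain p where "p \<in> topspace (realization_sum X)" "c = realization_class X p"
    using assms unfolding realization_def realization_class_def by (rule quotient_topology_cases)
  then show thesis
    using that by (auto simp: topspace_realization_sum)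
qed

lemma realization_class_glue:
  assumes "(p, p') \<in> realization_glue X" "p \<in> topspace (realization_sum X)"
    "p' \<in> topspace (realization_sum X)"
  shows "realization_class X p = realization_class X p'"
  unfolding realization_class_def using assms by (rule quotient_class_eq)

lemma realization_cell_continuous:
  assumes "x \<in> topspace (level X n)"
  shows "continuous_map (subtopology (powertop_real UNIV) (standard_simplex n)) (realization X)
           (\<lambda>t. realization_class X (n, x, t))"
proof -
  let ?\<Delta> = "subtopology (powertop_real UNIV) (standard_simplex n)"
  have "continuous_map ?\<Delta> (prod_topology (level X n) ?\<Delta>) (\<lambda>t. (x, t))"
    by (rule continuous_map_pairedI) (use assms in auto)
  then have "continuous_map ?\<Delta> (realization_sum X) (\<lambda>t. (n, x, t))"
    unfolding realization_sum_def
    by (rule continuous_map_compose[OF _ continuous_map_component_injection[OF UNIV_I],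
          unfolded o_def])
  from continuous_map_compose[OF this realization_class_continuous] show ?thesis
    by (simp add: o_def)
qed

text \<open>The universal property of the realization for discrete levels: the disjoint union of the
  pieces is then one of simplices, and a map out of the realization is a family of maps on
  these simplices that agrees on glued points.\<close>

lemma realization_induced_map:
  assumes disc: "\<And>n. level X n = discrete_topology (S n)"
    and cont: "\<And>n x. x \<in> S n \<Longrightarrow>
      continuous_map (subtopology (powertop_real UNIV) (standard_simplex n)) Y (\<lambda>t. f (n, x, t))"
    and glue: "\<And>p p'. (p, p') \<in> realization_glue X \<Longrightarrow> p \<in> topspace (realization_sum X) \<Longrightarrow>
      p' \<in> topspace (realization_sum X) \<Longrightarrow> f p = f p'"
  obtains g where "continuous_map (realization X) Y g"
    "\<And>n x t. x \<in> S n \<Longrightarrow> t \<in> standard_simplex n \<Longrightarrow> g (realization_class X (n, x, t)) = f (n, x, t)"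
proof -
  have "continuous_map (realization_sum X) Y f"
    unfolding realization_sum_def disc
    by (intro continuous_map_from_sum_topology continuous_map_from_discrete_prod cont)
  from quotient_topology_induced_map[OF this glue]
  obtain g where "continuous_map (realization X) Y g"
      "\<And>p. p \<in> topspace (realization_sum X) \<Longrightarrow> g (realization_class X p) = f p"
    unfolding realization_def realization_class_def by blast
  then show thesis
    by (intro that[of g]) (auto simp: topspace_realization_sum disc)
qed


text \<open>A simplicial map sends glued points to glued points, so all representatives of a class are
  sent into one class.\<close>

lemma realization_map_class:
  assumes lev: "\<And>n x. x \<in> topspace (level X n) \<Longrightarrow> \<phi> n x \<in> topspace (level Y n)"
    and face: "\<And>n i x. i \<le> Suc n \<Longrightarrow> x \<in> topspace (level X (Suc n)) \<Longrightarrow>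
      \<phi> n (face X (Suc n) i x) = face Y (Suc n) i (\<phi> (Suc n) x)"
    and degen: "\<And>n j x. j \<le> n \<Longrightarrow> x \<in> topspace (level X n) \<Longrightarrow>
      \<phi> (Suc n) (degen X n j x) = degen Y n j (\<phi> n x)"
    and x: "x \<in> topspace (level X n)" and t: "t \<in> standard_simplex n"
  shows "realization_map Y \<phi> (realization_class X (n, x, t)) = realization_class Y (n, \<phi> n x, t)"
proof -
  let ?\<Phi> = "\<lambda>(n, x, t). (n, \<phi> n x, t)"
  let ?E = "generated_equiv (topspace (realization_sum X)) (realization_glue X)"
  have p: "(n, x, t) \<in> topspace (realization_sum X)"
    using x t by (simp add: topspace_realization_sum)
  have glue: "realization_class Y (?\<Phi> u) = realization_class Y (?\<Phi> v)"
    if uv: "(u, v) \<in> realization_glue X" "u \<in> topspace (realization_sum X)"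
      "v \<in> topspace (realization_sum X)" for u v
  proof (rule realization_class_glue)
    show "?\<Phi> u \<in> topspace (realization_sum Y)" "?\<Phi> v \<in> topspace (realization_sum Y)"
      using uv lev by (auto simp: topspace_realization_sum)
    from uv(1) show "(?\<Phi> u, ?\<Phi> v) \<in> realization_glue Y"
      unfolding realization_glue_def using lev face degen by fastforce
  qed
  have const: "realization_class Y (?\<Phi> u) = realization_class Y (n, \<phi> n x, t)"
    if "u \<in> ?E `` {(n, x, t)}" for u
  proof -
    from that have "((n, x, t), u) \<in> ?E"
      by simp
    then show ?thesis
      using generated_equiv_respects[of "(n, x, t)" u _ _ "\<lambda>u. realization_class Y (?\<Phi> u)", OF _ glue]
      by simp
  qed
  have "realization_map Y \<phi> (realization_class X (n, x, t))
      = (\<Union>u \<in> ?E `` {(n, x, t)}. realization_class Y (?\<Phi> u))"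
    unfolding realization_map_def realization_class_def by blast
  also have "\<dots> = (\<Union>u \<in> ?E `` {(n, x, t)}. realization_class Y (n, \<phi> n x, t))"
    using const by (rule SUP_cong[OF refl])
  also have "\<dots> = realization_class Y (n, \<phi> n x, t)"
    using equiv_class_self[OF equiv_generated_equiv p] by blast
  finally show ?thesis .
qed

lemma realization_map_continuous:
  assumes disc: "\<And>n. level X n = discrete_topology (S n)"
    and lev: "\<And>n x. x \<in> topspace (level X n) \<Longrightarrow> \<phi> n x \<in> topspace (level Y n)"
    and face: "\<And>n i x. i \<le> Suc n \<Longrightarrow> x \<in> topspace (level X (Suc n)) \<Longrightarrow>
      \<phi> n (face X (Suc n) i x) = face Y (Suc n) i (\<phi> (Suc n) x)"
    and degen: "\<And>n j x. j \<le> n \<Longrightarrow> x \<in> topspace (level X n) \<Longrightarrow>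
      \<phi> (Suc n) (degen X n j x) = degen Y n j (\<phi> n x)"
  shows "continuous_map (realization X) (realization Y) (realization_map Y \<phi>)"
proof -
  note on_cell = realization_map_class[of X \<phi> Y, OF lev face degen]
  let ?f = "\<lambda>p. realization_map Y \<phi> (realization_class X p)"
  have cont: "continuous_map (subtopology (powertop_real UNIV) (standard_simplex n)) (realization Y)
      (\<lambda>t. ?f (n, x, t))" if "x \<in> S n" for n x
  proof (rule continuous_map_eq[OF realization_cell_continuous])
    show "\<phi> n x \<in> topspace (level Y n)"
      using lev[of x n] that by (simp add: disc)
  qed (use on_cell[of x n] that in \<open>simp add: disc\<close>)
  have glue: "?f p = ?f p'" if "(p, p') \<in> realization_glue X"
      "p \<in> topspace (realization_sum X)" "p' \<in> topspace (realization_sum X)" for p p'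
    using realization_class_glue[OF that] by simp
  obtain g where g: "continuous_map (realization X) (realization Y) g"
      "\<And>n x t. x \<in> S n \<Longrightarrow> t \<in> standard_simplex n \<Longrightarrow>
        g (realization_class X (n, x, t)) = ?f (n, x, t)"
    by (rule realization_induced_map[where Y = "realization Y" and f = ?f, OF disc cont glue])
      blast+
  show ?thesis
  proof (rule continuous_map_eq[OF g(1)])
    fix c assume "c \<in> topspace (realization X)"
    then show "g c = realization_map Y \<phi> c"
      by (rule realization_cases) (simp add: g(2) disc)
  qed
qed


section \<open>Bar constructions of subgroups\<close>

lemma bar_face_restrict [simp]: "bar_face (G\<lparr>carrier := A\<rparr>) = bar_face G"
  by (simp add: bar_face_def fun_eq_iff)

lemma bar_degen_restrict [simp]: "bar_degen (G\<lparr>carrier := A\<rparr>) = bar_degen G"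
  by (simp add: bar_degen_def fun_eq_iff)

context group
begin

abbreviation bar_class :: "'a set \<Rightarrow> 'a list point \<Rightarrow> 'a list point set" where
  "bar_class A \<equiv> realization_class (B_simp \<infinity> (G\<lparr>carrier := A\<rparr>))"

lemma level_B_sub:
  assumes "subgroup A G"
  shows "level (B_simp \<infinity> (G\<lparr>carrier := A\<rparr>)) n
    = discrete_topology {gs. length gs = n \<and> set gs \<subseteq> A}"
  using group.Hom_tuples_infinity[OF subgroup_imp_group[OF assms], of n]
  by (simp add: B_simp_def)

lemma level_B_simp:
  "level (B_simp q G) n
    = discrete_topology {gs. length gs = n \<and> (\<exists>A \<in> nilpotent_subgroups q G. set gs \<subseteq> A)}"
  by (simp add: B_simp_def Hom_tuples_eq_Union)

lemma B_sub_cases: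
  assumes "subgroup A G" "c \<in> topspace (B_sub G A)"
  obtains n gs t where "length gs = n" "set gs \<subseteq> A" "t \<in> standard_simplex n"
    "c = bar_class A (n, gs, t)"
  using assms(2) unfolding B_sub_def B_space_def
  by (rule realization_cases) (auto simp: level_B_sub[OF assms(1)] that)

lemma bar_class_in_B_sub:
  assumes A: "subgroup A G" and gs: "length gs = n" "set gs \<subseteq> A" and t: "t \<in> standard_simplex n"
  shows "bar_class A (n, gs, t) \<in> topspace (B_sub G A)"
proof -
  have "(n, gs, t) \<in> topspace (realization_sum (B_simp \<infinity> (G\<lparr>carrier := A\<rparr>)))"
    using gs t by (simp add: topspace_realization_sum level_B_sub[OF A])
  then show ?thesis
    using realization_class_continuous unfolding B_sub_def B_space_def
    by (auto simp: continuous_map_def)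
qed

lemma B_incl_subgroup:
  assumes A: "subgroup A G" and B: "subgroup B G" and AB: "A \<subseteq> B"
  shows "continuous_map (B_sub G A) (B_sub G B) (B_incl \<infinity> (G\<lparr>carrier := B\<rparr>))"
    and "length gs = n \<Longrightarrow> set gs \<subseteq> A \<Longrightarrow> t \<in> standard_simplex n \<Longrightarrow>
      B_incl \<infinity> (G\<lparr>carrier := B\<rparr>) (bar_class A (n, gs, t)) = bar_class B (n, gs, t)"
proof -
  let ?X = "B_simp \<infinity> (G\<lparr>carrier := A\<rparr>)" and ?Y = "B_simp \<infinity> (G\<lparr>carrier := B\<rparr>)"
  have lev: "x \<in> topspace (level ?X n) \<Longrightarrow> x \<in> topspace (level ?Y n)" for n x
    using AB by (auto simp: level_B_sub[OF A] level_B_sub[OF B])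
  have fd: "face ?X = face ?Y" "degen ?X = degen ?Y"
    by (simp_all add: B_simp_def)
  show "continuous_map (B_sub G A) (B_sub G B) (B_incl \<infinity> (G\<lparr>carrier := B\<rparr>))"
    unfolding B_sub_def B_space_def B_incl_def
    by (rule realization_map_continuous[OF level_B_sub[OF A]]) (simp_all add: lev fd)
  show "length gs = n \<Longrightarrow> set gs \<subseteq> A \<Longrightarrow> t \<in> standard_simplex n \<Longrightarrow>
      B_incl \<infinity> (G\<lparr>carrier := B\<rparr>) (bar_class A (n, gs, t)) = bar_class B (n, gs, t)"
    unfolding B_incl_def
    by (rule realization_map_class) (simp_all add: lev fd level_B_sub[OF A])
qed

lemma B_incl_nilpotent_subgroup:
  assumes N: "A \<in> nilpotent_subgroups q G"
  shows "continuous_map (B_sub G A) (B_space q G) (B_incl q G)"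
    and "length gs = n \<Longrightarrow> set gs \<subseteq> A \<Longrightarrow> t \<in> standard_simplex n \<Longrightarrow>
      B_incl q G (bar_class A (n, gs, t)) = realization_class (B_simp q G) (n, gs, t)"
proof -
  let ?X = "B_simp \<infinity> (G\<lparr>carrier := A\<rparr>)" and ?Y = "B_simp q G"
  have A: "subgroup A G"
    using N by (simp add: nilpotent_subgroups_def)
  have lev: "x \<in> topspace (level ?X n) \<Longrightarrow> x \<in> topspace (level ?Y n)" for n x
    using N by (auto simp: level_B_sub[OF A] level_B_simp)
  have fd: "face ?X = face ?Y" "degen ?X = degen ?Y"
    by (simp_all add: B_simp_def)
  show "continuous_map (B_sub G A) (B_space q G) (B_incl q G)"
    unfolding B_sub_def B_space_def B_incl_def
    by (rule realization_map_continuous[OF level_B_sub[OF A]]) (simp_all add: lev fd)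
  show "length gs = n \<Longrightarrow> set gs \<subseteq> A \<Longrightarrow> t \<in> standard_simplex n \<Longrightarrow>
      B_incl q G (bar_class A (n, gs, t)) = realization_class (B_simp q G) (n, gs, t)"
    unfolding B_incl_def
    by (rule realization_map_class) (simp_all add: lev fd level_B_sub[OF A])
qed

lemma set_bar_face_subset:
  assumes "subgroup A G" "set gs \<subseteq> A" "length gs = Suc n" "i \<le> Suc n"
  shows "set (bar_face G (Suc n) i gs) \<subseteq> A"
proof (cases "i = 0 \<or> i = Suc n")
  case True
  then show ?thesis
    using assms(2) by (auto simp: bar_face_def dest: in_set_butlastD list.set_sel(2)[rotated])
      (metis assms(3) list.set_sel(2) list.size(3) nat.distinct(1) subsetD)
next
  case False
  then have "gs ! (i - 1) \<in> A" "gs ! i \<in> A"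
    using assms nth_mem by (auto simp: subset_iff)
  with False show ?thesis
    using assms(2) subgroup.m_closed[OF assms(1)]
    by (auto simp: bar_face_def dest: in_set_takeD in_set_dropD)
qed

text \<open>A gluing relation of \<open>B(q, G)\<close> takes place inside \<open>BA\<close> as soon as the tuple \<open>p'\<close> to which the
  face or degeneracy operator is applied lies in \<open>A\<close>: the other tuple \<open>p\<close> then lies in \<open>A\<close> as well,
  because \<open>A\<close> is closed under products and contains \<open>1\<close>.\<close>

lemma bar_construction_glue:
  assumes A: "subgroup A G" and glue: "(p, p') \<in> realization_glue (B_simp q G)"
    and p: "p \<in> topspace (realization_sum (B_simp q G))"
      "p' \<in> topspace (realization_sum (B_simp q G))"
    and pA: "set (fst (snd p')) \<subseteq> A"
  shows "set (fst (snd p)) \<subseteq> A \<and> bar_class A p = bar_class A p'"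
proof -
  let ?X = "B_simp \<infinity> (G\<lparr>carrier := A\<rparr>)"
  have fd: "face ?X = bar_face G" "degen ?X = bar_degen G"
      "face (B_simp q G) = bar_face G" "degen (B_simp q G) = bar_degen G"
    by (simp_all add: B_simp_def)
  from glue consider
      (face) n i gs t where "i \<le> Suc n" "gs \<in> topspace (level (B_simp q G) (Suc n))"
        "t \<in> standard_simplex n" "p = (n, bar_face G (Suc n) i gs, t)"
        "p' = (Suc n, gs, simplical_face i t)"
    | (degen) n j gs t where "j \<le> n" "gs \<in> topspace (level (B_simp q G) n)"
        "t \<in> standard_simplex (Suc n)" "p = (Suc n, bar_degen G n j gs, t)"
        "p' = (n, gs, simplicial_collapse j t)"
    unfolding realization_glue_def fd by blast
  then show ?thesis
  proof cases
    case face
    then have gs: "length gs = Suc n" "set gs \<subseteq> A"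
      using pA by (auto simp: level_B_simp)
    then have f: "set (bar_face G (Suc n) i gs) \<subseteq> A"
      using set_bar_face_subset[OF A] face by blast
    have "(p, p') \<in> realization_glue ?X"
      unfolding realization_glue_def fd level_B_sub[OF A] using face gs by auto
    moreover have "p \<in> topspace (realization_sum ?X)" "p' \<in> topspace (realization_sum ?X)"
      using p face f gs by (auto simp: topspace_realization_sum level_B_sub[OF A] level_B_simp)
    ultimately show ?thesis
      using realization_class_glue[of p p' ?X] f face(4) by simp
  next
    case degen
    then have gs: "length gs = n" "set gs \<subseteq> A"
      using pA by (auto simp: level_B_simp)
    then have f: "set (bar_degen G n j gs) \<subseteq> A"
      using subgroup.one_closed[OF A]
      by (auto simp: bar_degen_def dest: in_set_takeD in_set_dropD)
    have "(p, p') \<in> realization_glue ?X"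
      unfolding realization_glue_def fd level_B_sub[OF A] using degen gs by auto
    moreover have "p \<in> topspace (realization_sum ?X)" "p' \<in> topspace (realization_sum ?X)"
      using p degen f gs by (auto simp: topspace_realization_sum level_B_sub[OF A] level_B_simp)
    ultimately show ?thesis
      using realization_class_glue[of p p' ?X] f degen(4) by simp
  qed
qed

lemma colim_BA_inj_continuous:
  assumes "A \<in> nilpotent_subgroups q G"
  shows "continuous_map (B_sub G A) (colim_BA q G) (colim_BA_inj q G A)"
  unfolding colim_BA_def colim_BA_inj_def using assms by (rule colim_inj_continuous)

lemma colim_BA_inj_mono:
  assumes A: "A \<in> nilpotent_subgroups q G" and B: "B \<in> nilpotent_subgroups q G" and AB: "A \<subseteq> B"
    and gs: "length gs = n" "set gs \<subseteq> A" and t: "t \<in> standard_simplex n"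
  shows "colim_BA_inj q G A (bar_class A (n, gs, t)) = colim_BA_inj q G B (bar_class B (n, gs, t))"
proof -
  have sub: "subgroup A G" "subgroup B G"
    using A B by (simp_all add: nilpotent_subgroups_def)
  have "colim_BA_inj q G B (B_incl \<infinity> (G\<lparr>carrier := B\<rparr>) (bar_class A (n, gs, t)))
      = colim_BA_inj q G A (bar_class A (n, gs, t))"
    unfolding colim_BA_inj_def
    using B_incl_subgroup(2)[OF sub AB gs t] bar_class_in_B_sub[of _ gs n t] sub gs t AB
    by (intro colim_inj_transition A B AB) auto
  then show ?thesis
    by (simp add: B_incl_subgroup(2)[OF sub AB gs t])
qed

text \<open>Both sides agree with the image of the point of \<open>B(A \<inter> B)\<close> with the same coordinates. This is
  where closure of the poset under intersection is used.\<close>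

lemma colim_BA_inj_eq:
  assumes A: "A \<in> nilpotent_subgroups q G" and B: "B \<in> nilpotent_subgroups q G"
    and gs: "length gs = n" "set gs \<subseteq> A" "set gs \<subseteq> B" and t: "t \<in> standard_simplex n"
  shows "colim_BA_inj q G A (bar_class A (n, gs, t)) = colim_BA_inj q G B (bar_class B (n, gs, t))"
proof -
  have "A \<inter> B \<in> nilpotent_subgroups q G"
    using A B by (rule nilpotent_subgroups_Int)
  then show ?thesis
    using colim_BA_inj_mono[of "A \<inter> B" q A gs n t] colim_BA_inj_mono[of "A \<inter> B" q B gs n t] assms
    by simp
qed

text \<open>The comparison map, induced by the inclusions of the \<open>BA\<close>, which are compatible with each
  other as they fix representatives.\<close>

lemma colim_BA_to_B_space:
  obtains h where "continuous_map (colim_BA q G) (B_space q G) h"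
    "\<And>A x. A \<in> nilpotent_subgroups q G \<Longrightarrow> x \<in> topspace (B_sub G A) \<Longrightarrow>
      h (colim_BA_inj q G A x) = B_incl q G x"
proof -
  have compat: "B_incl q G (B_incl \<infinity> (G\<lparr>carrier := B\<rparr>) x) = B_incl q G x"
    if A: "A \<in> nilpotent_subgroups q G" and B: "B \<in> nilpotent_subgroups q G"
      and AB: "A \<subseteq> B" and x: "x \<in> topspace (B_sub G A)" for A B x
  proof -
    have sub: "subgroup A G" "subgroup B G"
      using A B by (simp_all add: nilpotent_subgroups_def)
    obtain n gs t where gs: "length gs = n" "set gs \<subseteq> A" "t \<in> standard_simplex n"
        and x: "x = bar_class A (n, gs, t)"
      by (rule B_sub_cases[OF sub(1) x])
    show ?thesis
      using B_incl_nilpotent_subgroup(2)[OF A gs] B_incl_nilpotent_subgroup(2)[OF B, of gs n t]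
        B_incl_subgroup(2)[OF sub AB gs] gs AB x by auto
  qed
  show thesis
    by (rule colim_induced_map[of "nilpotent_subgroups q G" "B_sub G" "B_space q G"
            "\<lambda>_. B_incl q G" "(\<subseteq>)" "\<lambda>A A'. B_incl \<infinity> (G\<lparr>carrier := A'\<rparr>)"])
      (auto simp: B_incl_nilpotent_subgroup(1) compat colim_BA_def colim_BA_inj_def intro: that)
qed

text \<open>The inverse of the comparison map. A subgroup \<open>N gs\<close> of class less than \<open>q\<close> is chosen for each
  tuple \<open>gs\<close>, and the simplex of \<open>gs\<close> is mapped into the colimit through \<open>B(N gs)\<close>; by
  \<open>colim_BA_inj_eq\<close> any other such subgroup gives the same map.\<close>

lemma B_space_to_colim_BA:
  obtains k where "continuous_map (B_space q G) (colim_BA q G) k"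
    "\<And>A n gs t. A \<in> nilpotent_subgroups q G \<Longrightarrow> length gs = n \<Longrightarrow> set gs \<subseteq> A \<Longrightarrow>
      t \<in> standard_simplex n \<Longrightarrow>
      k (realization_class (B_simp q G) (n, gs, t)) = colim_BA_inj q G A (bar_class A (n, gs, t))"
proof -
  define N where "N gs = (SOME A. A \<in> nilpotent_subgroups q G \<and> set gs \<subseteq> A)" for gs
  have N: "N gs \<in> nilpotent_subgroups q G \<and> set gs \<subseteq> N gs"
    if "\<exists>A \<in> nilpotent_subgroups q G. set gs \<subseteq> A" for gs
    unfolding N_def by (rule someI_ex) (use that in blast)
  define f where "f p = colim_BA_inj q G (N (fst (snd p))) (bar_class (N (fst (snd p))) p)" for p
  have f_eq: "f (n, gs, t) = colim_BA_inj q G A (bar_class A (n, gs, t))"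
    if A: "A \<in> nilpotent_subgroups q G" "length gs = n" "set gs \<subseteq> A" "t \<in> standard_simplex n"
    for A n gs t
    unfolding f_def using colim_BA_inj_eq[of "N gs" q A gs n t] N[of gs] that by auto
  obtain k where k: "continuous_map (B_space q G) (colim_BA q G) k"
      "\<And>n gs t. gs \<in> {gs. length gs = n \<and> (\<exists>A \<in> nilpotent_subgroups q G. set gs \<subseteq> A)} \<Longrightarrow>
        t \<in> standard_simplex n \<Longrightarrow> k (realization_class (B_simp q G) (n, gs, t)) = f (n, gs, t)"
  proof (rule realization_induced_map[OF level_B_simp, of q "colim_BA q G" f])
    fix n gs
    assume "gs \<in> {gs. length gs = n \<and> (\<exists>A \<in> nilpotent_subgroups q G. set gs \<subseteq> A)}"
    then have gs: "length gs = n" "set gs \<subseteq> N gs" "N gs \<in> nilpotent_subgroups q G"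
        "subgroup (N gs) G"
      using N[of gs] by (auto simp: nilpotent_subgroups_def)
    let ?\<Delta> = "subtopology (powertop_real UNIV) (standard_simplex n)"
    have "continuous_map ?\<Delta> (B_sub G (N gs)) (\<lambda>t. bar_class (N gs) (n, gs, t))"
      unfolding B_sub_def B_space_def
      by (rule realization_cell_continuous) (simp add: level_B_sub gs)
    from continuous_map_compose[OF this colim_BA_inj_continuous[OF gs(3)]]
    show "continuous_map ?\<Delta> (colim_BA q G) (\<lambda>t. f (n, gs, t))"
      by (simp add: f_def o_def)
  next
    fix p p'
    assume glue: "(p, p') \<in> realization_glue (B_simp q G)"
      and p: "p \<in> topspace (realization_sum (B_simp q G))"
        "p' \<in> topspace (realization_sum (B_simp q G))"
    obtain n gs t n' gs' t' where eq: "p = (n, gs, t)" "p' = (n', gs', t')"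
      by (metis prod_cases3)
    \<comment> \<open>A subgroup for the tuple that the operator is applied to serves for both, since the operator does not leave it.\<close>
    obtain A where A: "A \<in> nilpotent_subgroups q G" "set gs' \<subseteq> A"
      using p(2) eq by (auto simp: topspace_realization_sum level_B_simp)
    then have "subgroup A G"
      by (simp add: nilpotent_subgroups_def)
    from bar_construction_glue[OF this glue p] have "set gs \<subseteq> A" "bar_class A p = bar_class A p'"
      using A eq by auto
    then show "f p = f p'"
      using A p eq by (auto simp: f_eq topspace_realization_sum level_B_simp)
  qed (use that in \<open>auto simp: B_space_def\<close>)
  show thesis
  proof (rule that[OF k(1)])
    fix A n gs t
    assume "A \<in> nilpotent_subgroups q G" "length gs = n" "set gs \<subseteq> A" "t \<in> standard_simplex n"
    then show "k (realization_class (B_simp q G) (n, gs, t))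
        = colim_BA_inj q G A (bar_class A (n, gs, t))"
      using k(2)[of gs n t] f_eq by auto
  qed
qed

end

theorem theorem4p3:
  fixes G :: "('a, 'b) monoid_scheme" and q :: enat
  assumes "group G" and "finite (carrier G)" and "2 \<le> q"
  shows "\<exists>h. homeomorphic_map (colim_BA q G) (B_space q G) h \<and>
           (\<forall>A \<in> nilpotent_subgroups q G. \<forall>x \<in> topspace (B_sub G A).
              h (colim_BA_inj q G A x) = B_incl q G x)"
proof -
  interpret group G by fact
  obtain h where h: "continuous_map (colim_BA q G) (B_space q G) h"
      "\<And>A x. A \<in> nilpotent_subgroups q G \<Longrightarrow> x \<in> topspace (B_sub G A) \<Longrightarrow>
        h (colim_BA_inj q G A x) = B_incl q G x"
    by (rule colim_BA_to_B_space[of q]) blast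
  obtain k where k: "continuous_map (B_space q G) (colim_BA q G) k"
      "\<And>A n gs t. A \<in> nilpotent_subgroups q G \<Longrightarrow> length gs = n \<Longrightarrow> set gs \<subseteq> A \<Longrightarrow>
        t \<in> standard_simplex n \<Longrightarrow>
        k (realization_class (B_simp q G) (n, gs, t))
          = colim_BA_inj q G A (realization_class (B_simp \<infinity> (G\<lparr>carrier := A\<rparr>)) (n, gs, t))"
    by (rule B_space_to_colim_BA[of q]) blast
  have "homeomorphic_maps (colim_BA q G) (B_space q G) h k"
    unfolding homeomorphic_maps_def
  proof (intro conjI ballI h(1) k(1))
    fix c assume "c \<in> topspace (colim_BA q G)"
    then obtain A x where A: "A \<in> nilpotent_subgroups q G" and x: "x \<in> topspace (B_sub G A)"
        and c: "c = colim_BA_inj q G A x"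
      unfolding colim_BA_def colim_BA_inj_def by (rule colim_cases)
    from A have sub: "subgroup A G"
      by (simp add: nilpotent_subgroups_def)
    obtain n gs t where gs: "length gs = n" "set gs \<subseteq> A"
        "t \<in> standard_simplex n"
        and x': "x = realization_class (B_simp \<infinity> (G\<lparr>carrier := A\<rparr>)) (n, gs, t)"
      by (rule B_sub_cases[OF sub x])
    show "k (h c) = c"
      using h(2)[OF A x] B_incl_nilpotent_subgroup(2)[OF A gs] k(2)[OF A gs] c x' by simp
  next
    fix y assume "y \<in> topspace (B_space q G)"
    then obtain n gs t where "gs \<in> topspace (level (B_simp q G) n)" and t: "t \<in> standard_simplex n"
        and y: "y = realization_class (B_simp q G) (n, gs, t)"
      unfolding B_space_def by (rule realization_cases)
    then obtain A where A: "A \<in> nilpotent_subgroups q G" and gs: "length gs = n" "set gs \<subseteq> A"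
      by (auto simp: level_B_simp)
    let ?x = "realization_class (B_simp \<infinity> (G\<lparr>carrier := A\<rparr>)) (n, gs, t)"
    have "?x \<in> topspace (B_sub G A)"
      using A gs t by (intro bar_class_in_B_sub) (auto simp: nilpotent_subgroups_def)
    then show "h (k y) = y"
      using h(2)[OF A] B_incl_nilpotent_subgroup(2)[OF A gs t] k(2)[OF A gs t] y by simp
  qed
  with h(2) show ?thesis
    using homeomorphic_maps_imp_map by blast
qed

end
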